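(* Let $M$ be a complex manifold that is Kobayashi hyperbolic and taut, let $H$ be a smooth Hermitian metric on $M$ with associated norm $\|\cdot\|_H$ on tangent spaces, and let $K\subset M$ be compact. Then there exist constants $0<c_1\le c_2$ such that $$c_1\|v\|_H\le F_K(z,v)\le c_2\|v\|_H\qquad\text{for all }z\in K\text{ and }v\in T_zM .$$
   Context: Complex manifolds are connected, $TM$ is the holomorphic tangent bundle, $D=\{\zeta\in\mathbb{C}:|\zeta|<1\}$, and $\mathcal{O}(D,M)$ is the set of holomorphic maps $D\to M$. The Kobayashi infinitesimal pseudometric is $$F_K(z,v)=\inf\{\lambda>0:\exists\,h\in\mathcal{O}(D,M),\ h(0)=z,\ h'(0)=v/\lambda\},\quad z\in M,\ v\in T_zM,$$ and the Kobayashi pseudodistance is $d_K(x,y)=\inf_\gamma\int_0^1F_K(\gamma(s),\dot\gamma(s))\,ds$ over piecewise smooth curves joining $x$ to $y$. $M$ is Kobayashi hyperbolic if $d_K$ is a genuine distance; $M$ is taut if $\mathcal{O}(D,M)$ is a normal family (every sequence has a subsequence that either converges locally uniformly to an element of $\mathcal{O}(D,M)$ or is compactly divergent). In local holomorphic coordinates $H$ is a smooth field of positive definite Hermitian matrices $H(z)$ and $\|v\|_H^2=v^*H(z)v$ for $v\in T_zM$. On a taut Kobayashi hyperbolic manifold, $F_K$ is jointly continuous on $TM\setminus\{0\}$ and $F_K(z,v)>0$ for $v\ne0$. *)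

theory Defs
  imports "HOL-Complex_Analysis.Complex_Analysis"
begin

section \<open>Smooth and holomorphic maps between Euclidean spaces\<close>

text \<open>\<open>Ck_on k f S\<close> is only meant for open \<open>S\<close>.\<close>

primrec Ck_on :: "nat \<Rightarrow> ('a::real_normed_vector \<Rightarrow> 'b::real_normed_vector) \<Rightarrow> 'a set \<Rightarrow> bool" where
  "Ck_on 0 f S \<longleftrightarrow> continuous_on S f"
| "Ck_on (Suc k) f S \<longleftrightarrow>
     (\<forall>x\<in>S. f differentiable (at x)) \<and>
     (\<forall>u. Ck_on k (\<lambda>x. frechet_derivative f (at x) u) S)"

definition smooth_on :: "('a::real_normed_vector \<Rightarrow> 'b::real_normed_vector) \<Rightarrow> 'a set \<Rightarrow> bool" where
  "smooth_on f S \<longleftrightarrow> (\<forall>k. Ck_on k f S)"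

definition holomorphic_map_on :: "(complex^'n \<Rightarrow> complex^'m) \<Rightarrow> (complex^'n) set \<Rightarrow> bool" where
  "holomorphic_map_on f S \<longleftrightarrow>
     (\<forall>x\<in>S. \<exists>f'. (f has_derivative f') (at x) \<and> (\<forall>c v. f' (c *s v) = c *s f' v))"

section \<open>Complex manifolds\<close>

text \<open>A chart is a domain together with its coordinate map; the values of the coordinate map
  outside of the domain are irrelevant. A complex manifold of dimension \<open>CARD('n)\<close> is a topology
  with a (not necessarily maximal) holomorphic atlas.\<close>

type_synonym ('a, 'n) chart = "'a set \<times> ('a \<Rightarrow> complex^'n)"

abbreviation dom_of :: "('a, 'n) chart \<Rightarrow> 'a set" where
  "dom_of \<equiv> fst"

abbreviation coord :: "('a, 'n) chart \<Rightarrow> 'a \<Rightarrow> complex^'n" where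
  "coord \<equiv> snd"

definition chart_inv :: "('a, 'n) chart \<Rightarrow> complex^'n \<Rightarrow> 'a" where
  "chart_inv c = inv_into (dom_of c) (coord c)"

definition transition :: "('a, 'n) chart \<Rightarrow> ('a, 'n) chart \<Rightarrow> complex^'n \<Rightarrow> complex^'n" where
  "transition c c' = coord c' \<circ> chart_inv c"

definition complex_manifold :: "'a topology \<Rightarrow> ('a, 'n::finite) chart set \<Rightarrow> bool" where
  "complex_manifold X A \<longleftrightarrow>
     Hausdorff_space X \<and> second_countable X \<and> connected_space X \<and>
     (\<Union>c\<in>A. dom_of c) = topspace X \<and>
     (\<forall>c\<in>A. openin X (dom_of c) \<and> open (coord c ` dom_of c) \<and>
        homeomorphic_map (subtopology X (dom_of c)) (top_of_set (coord c ` dom_of c)) (coord c)) \<and>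
     (\<forall>c\<in>A. \<forall>c'\<in>A. holomorphic_map_on (transition c c') (coord c ` (dom_of c \<inter> dom_of c')))"

section \<open>The holomorphic tangent bundle\<close>

text \<open>A tangent vector at \<open>z\<close> is the family of its coordinate vectors in all charts around \<open>z\<close>,
  which transform by the derivatives of the transition maps. It is set to 0 at all
  other charts, so that equality of tangent vectors is equality of functions.\<close>

type_synonym ('a, 'n) tvec = "('a, 'n) chart \<Rightarrow> complex^'n"

definition tangent_space :: "('a, 'n::finite) chart set \<Rightarrow> 'a \<Rightarrow> ('a, 'n) tvec set" where
  "tangent_space A z =
     {v. (\<forall>c. c \<notin> A \<or> z \<notin> dom_of c \<longrightarrow> v c = 0) \<and>
         (\<forall>c\<in>A. \<forall>c'\<in>A. z \<in> dom_of c \<inter> dom_of c' \<longrightarrow>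
            v c' = frechet_derivative (transition c c') (at (coord c z)) (v c))}"

section \<open>The Kobayashi pseudometric and pseudodistance\<close>

abbreviation unit_disc :: "complex set" where
  "unit_disc \<equiv> ball 0 1"

definition hol_discs :: "'a topology \<Rightarrow> ('a, 'n::finite) chart set \<Rightarrow> (complex \<Rightarrow> 'a) set" where
  "hol_discs X A =
     {h. continuous_map (top_of_set unit_disc) X h \<and>
         (\<forall>c\<in>A. \<forall>i. (\<lambda>\<zeta>. coord c (h \<zeta>) $ i) holomorphic_on {\<zeta>\<in>unit_disc. h \<zeta> \<in> dom_of c})}"

text \<open>\<open>disc_deriv A h\<close> is the tangent vector \<open>h'(0)\<close> at \<open>h 0\<close>.\<close>

definition disc_deriv :: "('a, 'n::finite) chart set \<Rightarrow> (complex \<Rightarrow> 'a) \<Rightarrow> ('a, 'n) tvec" where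
  "disc_deriv A h =
     (\<lambda>c. if c \<in> A \<and> h 0 \<in> dom_of c then (\<chi> i. deriv (\<lambda>\<zeta>. coord c (h \<zeta>) $ i) 0) else 0)"

text \<open>For a point \<open>z\<close> of the manifold and a tangent vector \<open>v\<close> at \<open>z\<close>, the set below is nonempty
  (take a small affine disc in a chart) and bounded below, so \<open>Inf\<close> is the true infimum.\<close>

definition kobayashi_F ::
  "'a topology \<Rightarrow> ('a, 'n::finite) chart set \<Rightarrow> 'a \<Rightarrow> ('a, 'n) tvec \<Rightarrow> real" where
  "kobayashi_F X A z v =
     Inf {l. l > 0 \<and> (\<exists>h\<in>hol_discs X A. h 0 = z \<and> disc_deriv A h = (\<lambda>c. v c /\<^sub>R l))}"

text \<open>Smoothness on a closed interval means local extendability, in charts, to a smooth map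
  on an open neighbourhood.\<close>

definition smooth_curve_on :: "('a, 'n::finite) chart set \<Rightarrow> (real \<Rightarrow> 'a) \<Rightarrow> real set \<Rightarrow> bool" where
  "smooth_curve_on A \<gamma> I \<longleftrightarrow>
     (\<forall>t\<in>I. \<forall>c\<in>A. \<gamma> t \<in> dom_of c \<longrightarrow>
        (\<exists>J g. open J \<and> t \<in> J \<and> smooth_on g J \<and>
               (\<forall>s\<in>J \<inter> I. \<gamma> s \<in> dom_of c \<and> g s = coord c (\<gamma> s))))"

definition piecewise_smooth_curve ::
  "'a topology \<Rightarrow> ('a, 'n::finite) chart set \<Rightarrow> (real \<Rightarrow> 'a) \<Rightarrow> bool" where
  "piecewise_smooth_curve X A \<gamma> \<longleftrightarrow>
     pathin X \<gamma> \<and>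
     (\<exists>T. finite T \<and> {0, 1} \<subseteq> T \<and> T \<subseteq> {0..1} \<and>
        (\<forall>a\<in>T. \<forall>b\<in>T. a < b \<and> {a<..<b} \<inter> T = {} \<longrightarrow> smooth_curve_on A \<gamma> {a..b}))"

text \<open>At the finitely many break points of a piecewise smooth curve the velocity need not exist;
  the value there does not affect the length.\<close>

definition velocity :: "('a, 'n::finite) chart set \<Rightarrow> (real \<Rightarrow> 'a) \<Rightarrow> real \<Rightarrow> ('a, 'n) tvec" where
  "velocity A \<gamma> s =
     (\<lambda>c. if c \<in> A \<and> \<gamma> s \<in> dom_of c
          then vector_derivative (\<lambda>r. coord c (\<gamma> r)) (at s within {0..1}) else 0)"

definition kobayashi_length ::
  "'a topology \<Rightarrow> ('a, 'n::finite) chart set \<Rightarrow> (real \<Rightarrow> 'a) \<Rightarrow> ennreal" where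
  "kobayashi_length X A \<gamma> =
     (\<integral>\<^sup>+s\<in>{0..1}. ennreal (kobayashi_F X A (\<gamma> s) (velocity A \<gamma> s)) \<partial>lborel)"

definition kobayashi_d ::
  "'a topology \<Rightarrow> ('a, 'n::finite) chart set \<Rightarrow> 'a \<Rightarrow> 'a \<Rightarrow> ennreal" where
  "kobayashi_d X A x y =
     (INF \<gamma>\<in>{\<gamma>. piecewise_smooth_curve X A \<gamma> \<and> \<gamma> 0 = x \<and> \<gamma> 1 = y}. kobayashi_length X A \<gamma>)"

definition kobayashi_hyperbolic :: "'a topology \<Rightarrow> ('a, 'n::finite) chart set \<Rightarrow> bool" where
  "kobayashi_hyperbolic X A \<longleftrightarrow>
     (\<forall>x\<in>topspace X. \<forall>y\<in>topspace X. kobayashi_d X A x y < \<infinity>) \<and>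
     Metric_space (topspace X) (\<lambda>x y. enn2real (kobayashi_d X A x y))"

section \<open>Tautness\<close>

text \<open>Local uniformity refers to a metric inducing the topology of the manifold; for
  continuous limit maps the notion does not depend on the choice of that metric.\<close>

definition locally_uniform_limit ::
  "'a topology \<Rightarrow> (nat \<Rightarrow> complex \<Rightarrow> 'a) \<Rightarrow> (complex \<Rightarrow> 'a) \<Rightarrow> bool" where
  "locally_uniform_limit X h g \<longleftrightarrow>
     (\<exists>d. Metric_space (topspace X) d \<and> Metric_space.mtopology (topspace X) d = X \<and>
        (\<forall>\<zeta>\<in>unit_disc. \<exists>N. open N \<and> \<zeta> \<in> N \<and> N \<subseteq> unit_disc \<and>
           (\<forall>\<epsilon>>0. \<forall>\<^sub>F k in sequentially. \<forall>w\<in>N. d (h k w) (g w) < \<epsilon>)))"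

definition compactly_divergent :: "'a topology \<Rightarrow> (nat \<Rightarrow> complex \<Rightarrow> 'a) \<Rightarrow> bool" where
  "compactly_divergent X h \<longleftrightarrow>
     (\<forall>L K. compact L \<and> L \<subseteq> unit_disc \<and> compactin X K \<longrightarrow>
        (\<forall>\<^sub>F k in sequentially. h k ` L \<inter> K = {}))"

definition taut :: "'a topology \<Rightarrow> ('a, 'n::finite) chart set \<Rightarrow> bool" where
  "taut X A \<longleftrightarrow>
     (\<forall>h. (\<forall>k. h k \<in> hol_discs X A) \<longrightarrow>
        (\<exists>r :: nat \<Rightarrow> nat. strict_mono r \<and>
           ((\<exists>g\<in>hol_discs X A. locally_uniform_limit X (h \<circ> r) g) \<or>
            compactly_divergent X (h \<circ> r))))"

section \<open>Hermitian metrics\<close>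

definition hermitian_form :: "complex^'n^'n \<Rightarrow> complex^'n \<Rightarrow> complex^'n \<Rightarrow> complex" where
  "hermitian_form G v w = (\<Sum>i\<in>UNIV. \<Sum>j\<in>UNIV. cnj (v $ i) * G $ i $ j * w $ j)"

definition pos_def_hermitian :: "complex^'n^'n \<Rightarrow> bool" where
  "pos_def_hermitian G \<longleftrightarrow>
     (\<forall>i j. G $ i $ j = cnj (G $ j $ i)) \<and> (\<forall>v. v \<noteq> 0 \<longrightarrow> Re (hermitian_form G v v) > 0)"

text \<open>\<open>H z\<close> is a sesquilinear form on the tangent space at \<open>z\<close>, given in each chart by a smooth
  field \<open>G\<close> of positive definite Hermitian matrices.\<close>

definition hermitian_metric ::
  "('a, 'n::finite) chart set \<Rightarrow> ('a \<Rightarrow> ('a, 'n) tvec \<Rightarrow> ('a, 'n) tvec \<Rightarrow> complex) \<Rightarrow> bool" where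
  "hermitian_metric A H \<longleftrightarrow>
     (\<forall>c\<in>A. \<exists>G :: complex^'n \<Rightarrow> complex^'n^'n.
        smooth_on G (coord c ` dom_of c) \<and>
        (\<forall>x\<in>coord c ` dom_of c. pos_def_hermitian (G x)) \<and>
        (\<forall>z\<in>dom_of c. \<forall>v\<in>tangent_space A z. \<forall>w\<in>tangent_space A z.
           H z v w = hermitian_form (G (coord c z)) (v c) (w c)))"

definition hermitian_norm ::
  "('a \<Rightarrow> ('a, 'n) tvec \<Rightarrow> ('a, 'n) tvec \<Rightarrow> complex) \<Rightarrow> 'a \<Rightarrow> ('a, 'n) tvec \<Rightarrow> real" where
  "hermitian_norm H z v = sqrt (Re (H z v v))"

end

theory Submission
  imports Defs
begin

text \<open>Everything is local: \<open>K\<close> is covered by finitely many small coordinate balls, and on each of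
  them both \<open>\<parallel>v\<parallel>\<^sub>H\<close> and \<open>F\<^sub>K(z,v)\<close> are compared with the Euclidean norm \<open>|v|\<close> of the coordinate
  vector of \<open>v\<close>; this is \<open>local_comparison\<close>.

  For \<open>\<parallel>v\<parallel>\<^sub>H\<close> the comparison is compactness of (closed ball) \<open>\<times>\<close> (unit sphere):
  \<open>pos_def_field_comparable\<close>. The upper bound \<open>F\<^sub>K(z,v) \<le> |v|/r\<close> holds because the coordinate
  ball of radius \<open>r\<close> about \<open>z\<close> contains the affine discs through \<open>z\<close> with derivative of norm
  less than \<open>r\<close> (\<open>affine_disc\<close>, \<open>kobayashi_F_le\<close>).

  The lower bound is where tautness enters. It amounts to a uniform bound on \<open>|h'(0)|\<close> over all
  holomorphic discs \<open>h\<close> centred in a compact part of a chart (\<open>kobayashi_F_ge\<close>,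
  \<open>taut_disc_deriv_bounded\<close>). If there were none, there would be discs \<open>h\<^sub>k\<close> with
  \<open>|h\<^sub>k'(0)| \<longlonglongrightarrow> \<infinity>\<close>. Their centres stay in a compact set, so no subsequence is compactly divergent
  and some subsequence converges locally uniformly to a disc \<open>g\<close>. Near \<open>0\<close> the disc \<open>g\<close> stays
  close to \<open>g(0)\<close>, hence late members of the subsequence map one fixed disc about \<open>0\<close> into a
  bounded part of the chart, and Cauchy's estimate bounds their derivatives, a contradiction.\<close>

section \<open>Coordinate charts\<close>

lemma manifold_chart:
  fixes A :: "('a, 'n::finite) chart set"
  assumes "complex_manifold X A" "c \<in> A"
  shows "openin X (dom_of c)" and "open (coord c ` dom_of c)"
    and "homeomorphic_map (subtopology X (dom_of c)) (top_of_set (coord c ` dom_of c)) (coord c)"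
  using assms by (auto simp: complex_manifold_def)

lemma topspace_chart:
  assumes "complex_manifold X A" "c \<in> A"
  shows "topspace (subtopology X (dom_of c)) = dom_of c"
  using openin_subset[OF manifold_chart(1)[OF assms]] by auto

lemma chart_inv_coord:
  fixes A :: "('a, 'n::finite) chart set"
  assumes "complex_manifold X A" "c \<in> A" "z \<in> dom_of c"
  shows "chart_inv c (coord c z) = z"
proof -
  have "inj_on (coord c) (dom_of c)"
    using homeomorphic_imp_injective_map[OF manifold_chart(3)[OF assms(1,2)]]
      topspace_chart[OF assms(1,2)] by simp
  then show ?thesis
    using assms(3) by (simp add: chart_inv_def)
qed

lemma chart_inv_in_dom: "x \<in> coord c ` dom_of c \<Longrightarrow> chart_inv c x \<in> dom_of c"
  by (simp add: chart_inv_def inv_into_into)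

lemma coord_chart_inv: "x \<in> coord c ` dom_of c \<Longrightarrow> coord c (chart_inv c x) = x"
  by (simp add: chart_inv_def f_inv_into_f)

lemma continuous_map_chart_inv:
  fixes A :: "('a, 'n::finite) chart set"
  assumes M: "complex_manifold X A" "c \<in> A"
  shows "continuous_map (top_of_set (coord c ` dom_of c)) X (chart_inv c)"
proof -
  obtain g where g: "homeomorphic_maps (subtopology X (dom_of c))
      (top_of_set (coord c ` dom_of c)) (coord c) g"
    using manifold_chart(3)[OF M] homeomorphic_map_maps by blast
  have "continuous_map (top_of_set (coord c ` dom_of c)) X g"
    using g by (auto simp: homeomorphic_maps_def continuous_map_in_subtopology)
  moreover have "g x = chart_inv c x" if "x \<in> coord c ` dom_of c" for x
    using that g openin_subset[OF manifold_chart(1)[OF M]]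
    by (auto simp: homeomorphic_maps_def chart_inv_coord[OF M])
  ultimately show ?thesis
    by (auto intro: continuous_map_eq)
qed

lemma openin_coord_preimage:
  fixes A :: "('a, 'n::finite) chart set"
  assumes M: "complex_manifold X A" "c \<in> A" and "open S"
  shows "openin X {z \<in> dom_of c. coord c z \<in> S}"
proof -
  have "continuous_map (subtopology X (dom_of c)) euclidean (coord c)"
    using homeomorphic_imp_continuous_map[OF manifold_chart(3)[OF M]]
    by (simp add: continuous_map_in_subtopology)
  then have "openin (subtopology X (dom_of c)) {z \<in> topspace (subtopology X (dom_of c)). coord c z \<in> S}"
    using \<open>open S\<close> by (intro openin_continuous_map_preimage) auto
  then show ?thesis
    unfolding topspace_chart[OF M] using manifold_chart(1)[OF M] openin_trans_full by blast
qed

lemma compactin_coord_preimage: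
  fixes A :: "('a, 'n::finite) chart set"
  assumes M: "complex_manifold X A" "c \<in> A"
    and S: "compact S" "S \<subseteq> coord c ` dom_of c"
  shows "compactin X {z \<in> dom_of c. coord c z \<in> S}"
proof -
  have "compactin X (chart_inv c ` S)"
    using S by (intro image_compactin[OF _ continuous_map_chart_inv[OF M]])
      (auto simp: compactin_subtopology)
  moreover have "chart_inv c ` S = {z \<in> dom_of c. coord c z \<in> S}"
  proof (intro equalityI subsetI)
    fix z assume "z \<in> {z \<in> dom_of c. coord c z \<in> S}"
    then show "z \<in> chart_inv c ` S"
      using chart_inv_coord[OF M, of z] by (intro image_eqI[of z _ "coord c z"]) auto
  next
    fix z assume "z \<in> chart_inv c ` S"
    then obtain x where x: "x \<in> S" "z = chart_inv c x" by (rule imageE) simp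
    then show "z \<in> {z \<in> dom_of c. coord c z \<in> S}"
      using chart_inv_in_dom[OF subsetD[OF S(2) x(1)]] coord_chart_inv[OF subsetD[OF S(2) x(1)]]
      by simp
  qed
  ultimately show ?thesis by simp
qed

section \<open>Affine discs and the upper bound\<close>

lemma norm_vector_scalar_mult: "norm (\<zeta> *s w) = norm \<zeta> * norm (w :: complex^'n)"
  by (simp add: norm_vec_def norm_mult L2_set_right_distrib)

lemma holomorphic_map_on_field_derivative_along_line:
  fixes f :: "complex^'n \<Rightarrow> complex^'m" and w :: "complex^'n"
  assumes "holomorphic_map_on f S" "x + \<zeta> *s w \<in> S"
  shows "((\<lambda>\<zeta>. f (x + \<zeta> *s w) $ i) has_field_derivative
           (frechet_derivative f (at (x + \<zeta> *s w)) w $ i)) (at \<zeta>)"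
proof -
  obtain f' where f': "(f has_derivative f') (at (x + \<zeta> *s w))" "\<And>c v. f' (c *s v) = c *s f' v"
    using assms unfolding holomorphic_map_on_def by blast
  have eq: "frechet_derivative f (at (x + \<zeta> *s w)) = f'"
    using frechet_derivative_at[OF f'(1)] by simp
  have bl: "bounded_linear (\<lambda>\<zeta>. \<zeta> *s w)"
    by (rule bounded_linear_intro[where K = "norm w"])
      (auto simp: vec_eq_iff algebra_simps norm_vector_scalar_mult)
  have "((\<lambda>\<zeta>. x + \<zeta> *s w) has_derivative (\<lambda>h. h *s w)) (at \<zeta>)"
    using bounded_linear_imp_has_derivative[OF bl] by (auto intro!: derivative_eq_intros)
  then have "((\<lambda>\<zeta>. f (x + \<zeta> *s w)) has_derivative (\<lambda>h. f' (h *s w))) (at \<zeta>)"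
    using has_derivative_compose f'(1) by blast
  then have "((\<lambda>\<zeta>. f (x + \<zeta> *s w) $ i) has_derivative (\<lambda>h. f' (h *s w) $ i)) (at \<zeta>)"
    using bounded_linear.has_derivative[OF bounded_linear_vec_nth] by blast
  moreover have "(\<lambda>h. f' (h *s w) $ i) = (*) (f' w $ i)"
    using f'(2) by (auto simp: mult.commute)
  ultimately show ?thesis
    by (simp add: has_field_derivative_def eq)
qed

lemma tangent_space_transform:
  assumes "v \<in> tangent_space A z" "c \<in> A" "c' \<in> A" "z \<in> dom_of c" "z \<in> dom_of c'"
  shows "v c' = frechet_derivative (transition c c') (at (coord c z)) (v c)"
proof -
  have "\<forall>c\<in>A. \<forall>c'\<in>A. z \<in> dom_of c \<inter> dom_of c' \<longrightarrow>
      v c' = frechet_derivative (transition c c') (at (coord c z)) (v c)"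
    using assms(1) unfolding tangent_space_def mem_Collect_eq by (rule conjunct2)
  from this[rule_format, OF assms(2,3) IntI[OF assms(4,5)]] show ?thesis .
qed

lemma tangent_space_zero:
  assumes "v \<in> tangent_space A z" "c \<notin> A \<or> z \<notin> dom_of c"
  shows "v c = 0"
  using conjunct1[OF assms(1)[unfolded tangent_space_def mem_Collect_eq]] assms(2) by blast

text \<open>The disc \<open>\<zeta> \<mapsto> x + \<zeta> v/l\<close>, drawn in the chart \<open>c\<close> around the coordinate \<open>x\<close> of \<open>z\<close>, stays in
  the chart because \<open>|v/l| < r\<close>. In the other charts its derivative at \<open>0\<close> is the image of \<open>v/l\<close>
  under the derivative of the transition map, and this is how tangent vectors transform.\<close>

lemma affine_disc:
  fixes A :: "('a, 'n::finite) chart set"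
  assumes M: "complex_manifold X A" "c \<in> A"
    and z: "z \<in> dom_of c" and v: "v \<in> tangent_space A z"
    and r: "ball (coord c z) r \<subseteq> coord c ` dom_of c"
    and l: "l > 0" "norm (v c) < l * r"
  shows "\<exists>h\<in>hol_discs X A. h 0 = z \<and> disc_deriv A h = (\<lambda>c. v c /\<^sub>R l)"
proof -
  define w where "w = v c /\<^sub>R l"
  define p where "p \<zeta> = coord c z + \<zeta> *s w" for \<zeta>
  define h where "h \<zeta> = chart_inv c (p \<zeta>)" for \<zeta>
  have nw: "norm w < r"
    using l by (simp add: w_def field_simps)
  have p_in: "p \<zeta> \<in> coord c ` dom_of c" if "\<zeta> \<in> unit_disc" for \<zeta>
  proof -
    have "norm \<zeta> * norm w \<le> 1 * norm w"
      using that by (intro mult_right_mono) auto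
    then have "p \<zeta> \<in> ball (coord c z) r"
      using nw by (simp add: p_def dist_norm norm_vector_scalar_mult)
    then show ?thesis using r by blast
  qed
  have h0: "h 0 = z"
    by (simp add: h_def p_def chart_inv_coord[OF M z])
  have D: "((\<lambda>\<zeta>. coord c' (h \<zeta>) $ i) has_field_derivative
      (frechet_derivative (transition c c') (at (p \<zeta>)) w $ i)) (at \<zeta>)"
    if "c' \<in> A" "\<zeta> \<in> unit_disc" "h \<zeta> \<in> dom_of c'" for c' i \<zeta>
  proof -
    have "holomorphic_map_on (transition c c') (coord c ` (dom_of c \<inter> dom_of c'))"
      using M \<open>c' \<in> A\<close> by (simp add: complex_manifold_def)
    moreover have "p \<zeta> \<in> coord c ` (dom_of c \<inter> dom_of c')"
      using that(3) chart_inv_in_dom[OF p_in[OF that(2)]] coord_chart_inv[OF p_in[OF that(2)]]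
      unfolding h_def by (metis IntI image_eqI)
    ultimately show ?thesis
      using holomorphic_map_on_field_derivative_along_line
      unfolding p_def h_def transition_def o_def by blast
  qed
  have "h \<in> hol_discs X A"
  proof -
    have "continuous_on unit_disc p"
      unfolding p_def by (intro continuous_intros)
        (auto simp: vector_scalar_mult_def intro!: continuous_intros)
    then have "continuous_map (top_of_set unit_disc) (top_of_set (coord c ` dom_of c)) p"
      using p_in by (auto simp: continuous_map_in_subtopology)
    then have "continuous_map (top_of_set unit_disc) X h"
      using continuous_map_compose[OF _ continuous_map_chart_inv[OF M]]
      unfolding h_def o_def by blast
    moreover have "(\<lambda>\<zeta>. coord c' (h \<zeta>) $ i) holomorphic_on {\<zeta> \<in> unit_disc. h \<zeta> \<in> dom_of c'}"
      if "c' \<in> A" for c' i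
      unfolding holomorphic_on_def field_differentiable_def
      using D[OF that] has_field_derivative_at_within by blast
    ultimately show ?thesis by (auto simp: hol_discs_def)
  qed
  moreover have "disc_deriv A h = (\<lambda>c. v c /\<^sub>R l)"
  proof
    fix c'
    show "disc_deriv A h c' = v c' /\<^sub>R l"
    proof (cases "c' \<in> A \<and> z \<in> dom_of c'")
      case True
      have "holomorphic_map_on (transition c c') (coord c ` (dom_of c \<inter> dom_of c'))"
        using M True by (simp add: complex_manifold_def)
      then have "transition c c' differentiable (at (coord c z))"
        using z True by (auto simp: holomorphic_map_on_def differentiable_def)
      then have lin: "linear (frechet_derivative (transition c c') (at (coord c z)))"
        by (rule linear_frechet_derivative)
      have "deriv (\<lambda>\<zeta>. coord c' (h \<zeta>) $ i) 0 =
          frechet_derivative (transition c c') (at (coord c z)) w $ i" for i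
        using DERIV_imp_deriv[OF D[of c' 0 i]] True h0 by (simp add: p_def)
      then have "disc_deriv A h c' = frechet_derivative (transition c c') (at (coord c z)) w"
        using True h0 by (simp add: disc_deriv_def vec_eq_iff)
      also have "\<dots> = frechet_derivative (transition c c') (at (coord c z)) (v c) /\<^sub>R l"
        unfolding w_def by (rule linear_scale[OF lin])
      also have "frechet_derivative (transition c c') (at (coord c z)) (v c) = v c'"
        using tangent_space_transform[OF v \<open>c \<in> A\<close> _ z, of c'] True by simp
      finally show ?thesis .
    next
      case False
      then show ?thesis
        using tangent_space_zero[OF v, of c'] h0 by (auto simp: disc_deriv_def)
    qed
  qed
  ultimately show ?thesis using h0 by blast
qed

lemma kobayashi_F_le:
  fixes A :: "('a, 'n::finite) chart set"
  assumes M: "complex_manifold X A" "c \<in> A"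
    and z: "z \<in> dom_of c" and v: "v \<in> tangent_space A z"
    and r: "r > 0" "ball (coord c z) r \<subseteq> coord c ` dom_of c"
  shows "kobayashi_F X A z v \<le> norm (v c) / r"
proof (rule dense_ge)
  fix l assume l: "norm (v c) / r < l"
  then have "0 < l"
    using r(1) by (smt (verit) divide_nonneg_pos norm_ge_zero)
  moreover have "norm (v c) < l * r"
    using l r(1) by (simp add: field_simps)
  ultimately have "l \<in> {l. l > 0 \<and> (\<exists>h\<in>hol_discs X A. h 0 = z \<and> disc_deriv A h = (\<lambda>c. v c /\<^sub>R l))}"
    using affine_disc[OF M z v r(2)] by blast
  then show "kobayashi_F X A z v \<le> l"
    unfolding kobayashi_F_def by (intro cInf_lower) (auto intro!: bdd_belowI[of _ 0])
qed

text \<open>A bound on the derivatives of the discs centred at \<open>z\<close> bounds every competitor \<open>l\<close> from below.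
  The competitors must also be shown to exist, since the infimum of the empty set is
  unspecified; a small affine disc provides one.\<close>

lemma kobayashi_F_ge:
  fixes A :: "('a, 'n::finite) chart set"
  assumes M: "complex_manifold X A" "c \<in> A"
    and z: "z \<in> dom_of c" and v: "v \<in> tangent_space A z"
    and C: "C > 0" "\<And>h. h \<in> hol_discs X A \<Longrightarrow> h 0 = z \<Longrightarrow> norm (disc_deriv A h c) \<le> C"
  shows "norm (v c) / C \<le> kobayashi_F X A z v"
  unfolding kobayashi_F_def
proof (rule cInf_greatest)
  have "coord c z \<in> coord c ` dom_of c" using z by blast
  then obtain r where r: "r > 0" "ball (coord c z) r \<subseteq> coord c ` dom_of c"
    using manifold_chart(2)[OF M] open_contains_ball by blast
  \<comment> \<open>The summand 1 keeps \<open>l\<close> positive for \<open>v = 0\<close> and makes the inequality strict.\<close>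
  define l where "l = (norm (v c) + 1) / r"
  have "l > 0" "norm (v c) < l * r"
    using r(1) by (auto simp: l_def add_nonneg_pos)
  then show "{l. l > 0 \<and> (\<exists>h\<in>hol_discs X A. h 0 = z \<and> disc_deriv A h = (\<lambda>c. v c /\<^sub>R l))} \<noteq> {}"
    using affine_disc[OF M z v r(2)] by blast
next
  fix l assume "l \<in> {l. l > 0 \<and> (\<exists>h\<in>hol_discs X A. h 0 = z \<and> disc_deriv A h = (\<lambda>c. v c /\<^sub>R l))}"
  then obtain h where h: "l > 0" "h \<in> hol_discs X A" "h 0 = z" "disc_deriv A h = (\<lambda>c. v c /\<^sub>R l)"
    by blast
  have "norm (v c) / l \<le> C"
    using C(2)[OF h(2,3)] h(1,4) by (simp add: divide_inverse mult.commute)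
  then show "norm (v c) / C \<le> l"
    using h(1) C(1) by (simp add: field_simps)
qed

section \<open>Tautness and bounded derivatives of discs\<close>

text \<open>Cauchy's estimate. It is applied on the disc of radius \<open>\<delta>/2\<close>, where the coordinates of \<open>h\<close>
  are continuous up to the boundary, which explains the factor 2; the dimension comes from
  summing over the components.\<close>

lemma norm_disc_deriv_le:
  fixes A :: "('a, 'n::finite) chart set"
  assumes h: "h \<in> hol_discs X A" and c: "c \<in> A"
    and \<delta>: "0 < \<delta>" "\<delta> \<le> 1"
    and B: "\<And>\<zeta>. \<zeta> \<in> ball 0 \<delta> \<Longrightarrow> h \<zeta> \<in> dom_of c \<and> norm (coord c (h \<zeta>)) \<le> B"
  shows "norm (disc_deriv A h c) \<le> real CARD('n) * (2 * B / \<delta>)"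
proof -
  have comp: "norm (deriv (\<lambda>\<zeta>. coord c (h \<zeta>) $ i) 0) \<le> 2 * B / \<delta>" for i
  proof -
    let ?f = "\<lambda>\<zeta>. coord c (h \<zeta>) $ i"
    have "?f holomorphic_on {\<zeta> \<in> unit_disc. h \<zeta> \<in> dom_of c}"
      using h c by (auto simp: hol_discs_def)
    then have hol: "?f holomorphic_on ball 0 \<delta>"
      by (rule holomorphic_on_subset) (use B \<delta> in auto)
    have "norm ((deriv ^^ 1) ?f 0) \<le> fact 1 * B / (\<delta> / 2) ^ 1"
    proof (rule Cauchy_inequality)
      show "?f holomorphic_on ball 0 (\<delta> / 2)"
        using hol by (rule holomorphic_on_subset) (use \<delta> in auto)
      show "continuous_on (cball 0 (\<delta> / 2)) ?f"
        using holomorphic_on_imp_continuous_on[OF hol] by (rule continuous_on_subset) (use \<delta> in auto)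
      show "norm (?f x) \<le> B" if "norm (0 - x) = \<delta> / 2" for x
      proof -
        have "x \<in> ball 0 \<delta>" using that \<delta> by simp
        then show ?thesis using B Finite_Cartesian_Product.norm_nth_le order_trans by blast
      qed
    qed (use \<delta> in auto)
    then show ?thesis by (simp add: mult.commute)
  qed
  have "h 0 \<in> dom_of c" using B \<delta> by auto
  then have eq: "disc_deriv A h c $ i = deriv (\<lambda>\<zeta>. coord c (h \<zeta>) $ i) 0" for i
    using c by (simp add: disc_deriv_def)
  have "norm (disc_deriv A h c) \<le> (\<Sum>i\<in>UNIV. norm (disc_deriv A h c $ i))"
    unfolding norm_vec_def by (rule L2_set_le_sum) auto
  also have "\<dots> \<le> (\<Sum>i\<in>(UNIV :: 'n set). 2 * B / \<delta>)"
    using comp by (intro sum_mono) (simp add: eq)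
  finally show ?thesis by simp
qed

text \<open>The compactness argument: discs centred in \<open>L\<close> with unbounded derivatives cannot
  diverge compactly, and a limit disc would contradict Cauchy's estimate.\<close>

lemma taut_disc_deriv_bounded:
  fixes A :: "('a, 'n::finite) chart set"
  assumes M: "complex_manifold X A" "c \<in> A" and T: "taut X A"
    and L: "compactin X L" "L \<subseteq> dom_of c"
  shows "\<exists>C>0. \<forall>h\<in>hol_discs X A. h 0 \<in> L \<longrightarrow> norm (disc_deriv A h c) \<le> C"
proof (rule ccontr)
  assume "\<not> ?thesis"
  then have "\<forall>k::nat. \<exists>h\<in>hol_discs X A. h 0 \<in> L \<and> norm (disc_deriv A h c) > real k + 1"
    by (metis add_nonneg_pos not_le of_nat_0_le_iff zero_less_one)
  then obtain h where h: "\<And>k. h k \<in> hol_discs X A" "\<And>k. h k 0 \<in> L"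
      "\<And>k. norm (disc_deriv A (h k) c) > real k + 1"
    by metis
  obtain r :: "nat \<Rightarrow> nat" where r: "strict_mono r"
    "(\<exists>g\<in>hol_discs X A. locally_uniform_limit X (h \<circ> r) g) \<or> compactly_divergent X (h \<circ> r)"
    using T h(1) unfolding taut_def by blast
  have "\<not> compactly_divergent X (h \<circ> r)"
  proof
    assume "compactly_divergent X (h \<circ> r)"
    then have "\<forall>\<^sub>F k in sequentially. (h \<circ> r) k ` {0} \<inter> L = {}"
      using L(1) unfolding compactly_divergent_def
      by (metis centre_in_ball compact_sing empty_subsetI insert_subset zero_less_one)
    then show False
      using h(2) by (auto simp: eventually_sequentially)
  qed
  then obtain g where g: "g \<in> hol_discs X A" "locally_uniform_limit X (h \<circ> r) g"
    using r(2) by blast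
  obtain d where d: "Metric_space (topspace X) d" "Metric_space.mtopology (topspace X) d = X"
    and lim: "\<And>\<zeta>. \<zeta> \<in> unit_disc \<Longrightarrow> \<exists>N. open N \<and> \<zeta> \<in> N \<and> N \<subseteq> unit_disc \<and>
           (\<forall>\<epsilon>>0. \<forall>\<^sub>F k in sequentially. \<forall>w\<in>N. d ((h \<circ> r) k w) (g w) < \<epsilon>)"
    using g(2) unfolding locally_uniform_limit_def by blast
  interpret Metric_space "topspace X" d by (rule d(1))
  obtain N where N: "open N" "0 \<in> N" "N \<subseteq> unit_disc"
    and unif: "\<And>\<epsilon>. \<epsilon> > 0 \<Longrightarrow> \<forall>\<^sub>F k in sequentially. \<forall>w\<in>N. d (h (r k) w) (g w) < \<epsilon>"
    using lim[of 0] by auto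
  have in_X: "f \<zeta> \<in> topspace X" if "f \<in> hol_discs X A" "\<zeta> \<in> unit_disc" for f \<zeta>
    using that continuous_map_image_subset_topspace by (fastforce simp: hol_discs_def)
  have p_X: "g 0 \<in> topspace X" using in_X[OF g(1)] by simp
  \<comment> \<open>The centres lie in \<open>L\<close>, which is closed in the Hausdorff space \<open>X\<close>.\<close>
  have "g 0 \<in> L"
  proof (rule ccontr)
    assume "g 0 \<notin> L"
    have "closedin X L"
      using L(1) M(1) compactin_imp_closedin by (auto simp: complex_manifold_def)
    then have "openin mtopology (topspace X - L)" by (simp add: d(2) openin_diff)
    then obtain e where e: "e > 0" "mball (g 0) e \<subseteq> topspace X - L"
      using p_X \<open>g 0 \<notin> L\<close> unfolding openin_mtopology by blast
    obtain k where "d (h (r k) 0) (g 0) < e"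
      using eventually_happens[OF unif[OF e(1)]] N(2) by auto
    then have "h (r k) 0 \<in> mball (g 0) e"
      using p_X in_X[OF h(1), of 0] by (simp add: in_mball commute)
    then show False using e(2) h(2) by blast
  qed
  then have p: "g 0 \<in> dom_of c" using L(2) by blast
  \<comment> \<open>A neighbourhood of the limit centre, inside the chart, on which the coordinates are bounded.\<close>
  define B where "B = norm (coord c (g 0)) + 1"
  define V where "V = {z \<in> dom_of c. coord c z \<in> ball (coord c (g 0)) 1}"
  have "openin mtopology V"
    unfolding V_def d(2) by (rule openin_coord_preimage[OF M]) simp
  moreover have "g 0 \<in> V" using p by (simp add: V_def)
  ultimately obtain e where e: "e > 0" "mball (g 0) e \<subseteq> V"
    unfolding openin_mtopology by blast
  have VB: "norm (coord c z) \<le> B" if "z \<in> V" for z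
  proof -
    have "norm (coord c z - coord c (g 0)) < 1"
      using that by (simp add: V_def dist_norm norm_minus_commute)
    then show ?thesis
      unfolding B_def using norm_triangle_sub[of "coord c z" "coord c (g 0)"] by simp
  qed
  \<comment> \<open>On a disc of radius \<open>\<delta>\<close> the limit \<open>g\<close> moves by less than \<open>e/2\<close>, and the approximants are within
    \<open>e/2\<close> of \<open>g\<close>.\<close>
  have "openin (top_of_set unit_disc) {\<zeta> \<in> topspace (top_of_set unit_disc). g \<zeta> \<in> mball (g 0) (e/2)}"
    using g(1) openin_mball[of "g 0" "e/2"] d(2)
    by (intro openin_continuous_map_preimage) (auto simp: hol_discs_def)
  then have "open {\<zeta> \<in> unit_disc. g \<zeta> \<in> mball (g 0) (e/2)}"
    using openin_open_trans by fastforce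
  then have "open ({\<zeta> \<in> unit_disc. g \<zeta> \<in> mball (g 0) (e/2)} \<inter> N)"
    using N(1) by blast
  moreover have "0 \<in> {\<zeta> \<in> unit_disc. g \<zeta> \<in> mball (g 0) (e/2)} \<inter> N"
    using N(2) p_X e(1) by simp
  ultimately obtain \<delta> where \<delta>: "\<delta> > 0"
      "ball 0 \<delta> \<subseteq> {\<zeta> \<in> unit_disc. g \<zeta> \<in> mball (g 0) (e/2)} \<inter> N"
    using open_contains_ball by blast
  have "ball (0::complex) \<delta> \<subseteq> ball 0 1" using \<delta>(2) by blast
  then have \<delta>1: "\<delta> \<le> 1" using \<delta>(1) by (simp add: ball_subset_ball_iff)
  have "\<forall>\<^sub>F k in sequentially. \<forall>w\<in>N. d (h (r k) w) (g w) < e / 2"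
    by (rule unif) (use e(1) in simp)
  then have "\<forall>\<^sub>F k in sequentially. norm (disc_deriv A (h (r k)) c) \<le> real CARD('n) * (2 * B / \<delta>)"
  proof eventually_elim
    case (elim k)
    show ?case
    proof (rule norm_disc_deriv_le[OF h(1) M(2) \<delta>(1) \<delta>1])
      fix \<zeta> assume \<zeta>: "\<zeta> \<in> ball (0::complex) \<delta>"
      then have 1: "\<zeta> \<in> unit_disc" "g \<zeta> \<in> mball (g 0) (e/2)" "d (h (r k) \<zeta>) (g \<zeta>) < e/2"
        using \<delta>(2) elim by blast+
      have "d (g 0) (h (r k) \<zeta>) \<le> d (g 0) (g \<zeta>) + d (g \<zeta>) (h (r k) \<zeta>)"
        using p_X in_X[OF g(1) 1(1)] in_X[OF h(1) 1(1)] by (intro triangle)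
      also have "\<dots> < e" using 1(2,3) commute by (simp add: in_mball)
      finally have "h (r k) \<zeta> \<in> V"
        using e(2) p_X in_X[OF h(1) 1(1)] by (auto simp: in_mball)
      then show "h (r k) \<zeta> \<in> dom_of c \<and> norm (coord c (h (r k) \<zeta>)) \<le> B"
        using VB by (simp add: V_def)
    qed
  qed
  moreover have "\<forall>\<^sub>F k in sequentially. real CARD('n) * (2 * B / \<delta>) < real k"
    using filterlim_real_sequentially filterlim_at_top_dense by blast
  \<comment> \<open>Along the subsequence the derivatives exceed \<open>r k \<ge> k\<close>.\<close>
  ultimately have "\<forall>\<^sub>F k in sequentially. False"
  proof eventually_elim
    case (elim k)
    have "real k \<le> real (r k)" using seq_suble[OF r(1)] by simp
    then show ?case using elim h(3)[of "r k"] by linarith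
  qed
  then show False by simp
qed

section \<open>Comparison with the Hermitian norm\<close>

text \<open>By homogeneity it suffices to consider unit vectors, for which the constants are the minimum
  and the maximum of the form over the compact set \<open>S \<times> sphere 0 1\<close>.\<close>

lemma pos_def_field_comparable:
  fixes G :: "complex^'n \<Rightarrow> complex^'n^'n"
  assumes S: "compact S" "S \<noteq> {}" and G: "continuous_on S G"
    and pos: "\<And>x. x \<in> S \<Longrightarrow> pos_def_hermitian (G x)"
  shows "\<exists>a>0. \<exists>b>0. \<forall>x\<in>S. \<forall>v.
    a * (norm v)\<^sup>2 \<le> Re (hermitian_form (G x) v v) \<and> Re (hermitian_form (G x) v v) \<le> b * (norm v)\<^sup>2"
proof -
  let ?Q = "\<lambda>p. Re (hermitian_form (G (fst p)) (snd p) (snd p))"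
  let ?P = "S \<times> sphere (0 :: complex^'n) 1"
  have "compact ?P" using S(1) by (intro compact_Times) auto
  moreover have "?P \<noteq> {}" using S(2) by simp
  moreover have "continuous_on ?P ?Q"
  proof -
    have "continuous_on ?P (\<lambda>p. G (fst p))"
      by (rule continuous_on_compose2[OF G]) (auto intro: continuous_intros)
    then show ?thesis
      unfolding hermitian_form_def by (intro continuous_intros)
  qed
  ultimately obtain p q where p: "p \<in> ?P" "\<And>y. y \<in> ?P \<Longrightarrow> ?Q p \<le> ?Q y"
    and q: "q \<in> ?P" "\<And>y. y \<in> ?P \<Longrightarrow> ?Q y \<le> ?Q q"
    using continuous_attains_inf[of ?P ?Q] continuous_attains_sup[of ?P ?Q] by blast
  have posP: "?Q y > 0" if "y \<in> ?P" for y
  proof -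
    have "snd y \<noteq> 0" using that by auto
    then show ?thesis using that pos[of "fst y"] by (auto simp: pos_def_hermitian_def)
  qed
  have "?Q p * (norm v)\<^sup>2 \<le> Re (hermitian_form (G x) v v) \<and>
      Re (hermitian_form (G x) v v) \<le> ?Q q * (norm v)\<^sup>2" if x: "x \<in> S" for x v
  proof (cases "v = 0")
    case True
    then show ?thesis by (simp add: hermitian_form_def)
  next
    case False
    define u where "u = v /\<^sub>R norm v"
    have v: "v = norm v *\<^sub>R u" using False by (simp add: u_def)
    have "(x, u) \<in> ?P" using False x by (simp add: u_def)
    then have "?Q p \<le> ?Q (x, u)" "?Q (x, u) \<le> ?Q q" using p(2) q(2) by blast+
    moreover have "Re (hermitian_form (G x) v v) = ?Q (x, u) * (norm v)\<^sup>2"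
    proof -
      have "hermitian_form (G x) (t *\<^sub>R u) (t *\<^sub>R u) = t\<^sup>2 *\<^sub>R hermitian_form (G x) u u" for t :: real
        unfolding hermitian_form_def
        by (simp add: scaleR_sum_right power2_eq_square algebra_simps)
      then show ?thesis using v by (metis fst_conv snd_conv scaleR_complex.sel(1) mult.commute)
    qed
    ultimately show ?thesis by (simp add: mult_right_mono)
  qed
  then show ?thesis using posP[OF p(1)] posP[OF q(1)] by blast
qed

lemma smooth_on_imp_continuous_on: "smooth_on f S \<Longrightarrow> continuous_on S f"
  unfolding smooth_on_def by (metis Ck_on.simps(1))

text \<open>The neighbourhood is the preimage of a ball of half the radius of a ball that fits into the
  chart: its closure is then compact in the chart, as the bound on derivatives requires, and each of
  its points has a ball of the same radius inside the chart, as the affine discs require. The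
  nonnegativity of the norm is recorded because it allows to pass to other constants.\<close>

lemma local_comparison:
  fixes A :: "('a, 'n::finite) chart set"
  assumes M: "complex_manifold X A" and T: "taut X A" and H: "hermitian_metric A H"
    and z0: "z0 \<in> topspace X"
  shows "\<exists>U a b. openin X U \<and> z0 \<in> U \<and> 0 < a \<and> 0 < b \<and>
    (\<forall>z\<in>U. \<forall>v\<in>tangent_space A z. 0 \<le> hermitian_norm H z v \<and>
       a * hermitian_norm H z v \<le> kobayashi_F X A z v \<and>
       kobayashi_F X A z v \<le> b * hermitian_norm H z v)"
proof -
  obtain c where c: "c \<in> A" "z0 \<in> dom_of c"
    using M z0 unfolding complex_manifold_def by blast
  note Mc = M c(1)
  have "coord c z0 \<in> coord c ` dom_of c" using c(2) by blast
  then obtain s where s: "s > 0" "ball (coord c z0) s \<subseteq> coord c ` dom_of c"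
    using manifold_chart(2)[OF Mc] open_contains_ball by blast
  define r where "r = s / 2"
  define S where "S = cball (coord c z0) r"
  define L where "L = {z \<in> dom_of c. coord c z \<in> S}"
  define U where "U = {z \<in> dom_of c. coord c z \<in> ball (coord c z0) r}"
  have r: "r > 0" using s by (simp add: r_def)
  have S: "S \<subseteq> coord c ` dom_of c" "compact S" "S \<noteq> {}"
    using s by (auto simp: S_def r_def)
  have "compactin X L" unfolding L_def by (rule compactin_coord_preimage[OF Mc S(2,1)])
  then obtain C where C: "C > 0"
      "\<And>h. h \<in> hol_discs X A \<Longrightarrow> h 0 \<in> L \<Longrightarrow> norm (disc_deriv A h c) \<le> C"
    using taut_disc_deriv_bounded[OF Mc T, of L] by (auto simp: L_def)
  obtain G where G: "smooth_on G (coord c ` dom_of c)"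
      "\<And>x. x \<in> coord c ` dom_of c \<Longrightarrow> pos_def_hermitian (G x)"
      "\<And>z v. z \<in> dom_of c \<Longrightarrow> v \<in> tangent_space A z \<Longrightarrow>
         H z v v = hermitian_form (G (coord c z)) (v c) (v c)"
    using H c(1) unfolding hermitian_metric_def by metis
  have "continuous_on S G"
    using smooth_on_imp_continuous_on[OF G(1)] S(1) continuous_on_subset by blast
  then obtain m n where mn: "m > 0" "n > 0" "\<And>x v. x \<in> S \<Longrightarrow>
      m * (norm v)\<^sup>2 \<le> Re (hermitian_form (G x) v v) \<and> Re (hermitian_form (G x) v v) \<le> n * (norm v)\<^sup>2"
    using pos_def_field_comparable[OF S(2,3), of G] S(1) G(2) by (metis subsetD)
  have "0 \<le> hermitian_norm H z v \<and>
      1 / (C * sqrt n) * hermitian_norm H z v \<le> kobayashi_F X A z v \<and>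
      kobayashi_F X A z v \<le> 1 / (r * sqrt m) * hermitian_norm H z v"
    if z: "z \<in> U" and v: "v \<in> tangent_space A z" for z v
  proof -
    have zc: "z \<in> dom_of c" "coord c z \<in> S" "z \<in> L" using z by (auto simp: U_def S_def L_def)
    have sq: "m * (norm (v c))\<^sup>2 \<le> Re (H z v v)" "Re (H z v v) \<le> n * (norm (v c))\<^sup>2"
      using mn(3)[OF zc(2)] G(3)[OF zc(1) v] by auto
    have lo: "sqrt m * norm (v c) \<le> hermitian_norm H z v"
      using real_sqrt_le_mono[OF sq(1)] by (simp add: hermitian_norm_def real_sqrt_mult)
    have hi: "hermitian_norm H z v \<le> sqrt n * norm (v c)"
      using real_sqrt_le_mono[OF sq(2)] by (simp add: hermitian_norm_def real_sqrt_mult)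
    have "ball (coord c z) r \<subseteq> ball (coord c z0) s"
    proof
      fix y assume "y \<in> ball (coord c z) r"
      then show "y \<in> ball (coord c z0) s"
        using z dist_triangle[of "coord c z0" y "coord c z"] by (simp add: U_def r_def)
    qed
    then have up: "kobayashi_F X A z v \<le> norm (v c) / r"
      using s(2) by (intro kobayashi_F_le[OF Mc zc(1) v r]) blast
    have low: "norm (v c) / C \<le> kobayashi_F X A z v"
      using C zc(3) by (intro kobayashi_F_ge[OF Mc zc(1) v]) auto
    have "1 / (C * sqrt n) * hermitian_norm H z v \<le> norm (v c) / C"
      using hi C(1) mn(2) by (simp add: field_simps)
    moreover have "norm (v c) / r \<le> 1 / (r * sqrt m) * hermitian_norm H z v"
      using lo r mn(1) by (simp add: field_simps)
    moreover have "0 \<le> sqrt m * norm (v c)" using mn(1) by simp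
    ultimately show ?thesis using up low lo by linarith
  qed
  moreover have "openin X U" unfolding U_def by (rule openin_coord_preimage[OF Mc]) simp
  moreover have "z0 \<in> U" using c(2) r by (simp add: U_def)
  moreover have "0 < 1 / (C * sqrt n)" "0 < 1 / (r * sqrt m)" using C(1) mn r by auto
  ultimately show ?thesis
    by (intro exI[of _ U] exI[of _ "1 / (C * sqrt n)"] exI[of _ "1 / (r * sqrt m)"] conjI ballI)
      (assumption | simp only:)+
qed

theorem lemma4:
  fixes X :: "'a topology"
    and A :: "('a, 'n::finite) chart set"
    and H :: "'a \<Rightarrow> ('a, 'n) tvec \<Rightarrow> ('a, 'n) tvec \<Rightarrow> complex"
    and K :: "'a set"
  assumes "complex_manifold X A"
    and "kobayashi_hyperbolic X A"
    and "taut X A"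
    and "hermitian_metric A H"
    and "compactin X K"
  shows "\<exists>c1 c2 :: real. 0 < c1 \<and> c1 \<le> c2 \<and>
           (\<forall>z\<in>K. \<forall>v\<in>tangent_space A z.
              c1 * hermitian_norm H z v \<le> kobayashi_F X A z v \<and>
              kobayashi_F X A z v \<le> c2 * hermitian_norm H z v)"
proof -
  let ?N = "hermitian_norm H" and ?F = "kobayashi_F X A"
  \<comment> \<open>Folding the estimates into one predicate keeps the choice of \<open>U\<close>, \<open>a\<close> and \<open>b\<close> first-order.\<close>
  define cmp where "cmp W a b \<longleftrightarrow> (\<forall>z\<in>W. \<forall>v\<in>tangent_space A z.
      0 \<le> ?N z v \<and> a * ?N z v \<le> ?F z v \<and> ?F z v \<le> b * ?N z v)" for W and a b :: real
  have "\<forall>p\<in>topspace X. \<exists>U a b. openin X U \<and> p \<in> U \<and> 0 < a \<and> 0 < b \<and> cmp U a b"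
    unfolding cmp_def using local_comparison[OF assms(1,3,4)] by (rule ballI)
  then obtain U a b where U: "\<And>p. p \<in> topspace X \<Longrightarrow> openin X (U p) \<and> p \<in> U p"
    and ab: "\<And>p. p \<in> topspace X \<Longrightarrow> 0 < a p \<and> 0 < (b p :: real)"
    and cmp: "\<And>p. p \<in> topspace X \<Longrightarrow> cmp (U p) (a p) (b p)"
    by metis
  have KX: "K \<subseteq> topspace X" using assms(5) compactin_subset_topspace by blast
  have op: "openin X W" if "W \<in> U ` K" for W
    using that U subsetD[OF KX] by auto
  have cov: "K \<subseteq> \<Union>(U ` K)"
    using U subsetD[OF KX] by auto
  obtain \<F> where \<F>: "finite \<F>" "\<F> \<subseteq> U ` K" "K \<subseteq> \<Union>\<F>"
    using compactinD[OF assms(5) op cov] by auto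
  obtain P where P: "P \<subseteq> K" "finite P" "\<F> = U ` P"
    using finite_subset_image[OF \<F>(1,2)] by auto
  \<comment> \<open>Inserting 1 gives \<open>c1 \<le> 1 \<le> c2\<close>, and makes the sets nonempty even if \<open>K\<close> is empty.\<close>
  define c1 where "c1 = Min (insert 1 (a ` P))"
  define c2 where "c2 = Max (insert 1 (b ` P))"
  have "c1 > 0" using P ab KX by (auto simp: c1_def)
  moreover have "c1 \<le> 1" "1 \<le> c2" using P(2) by (auto simp: c1_def c2_def)
  moreover have "c1 * ?N z v \<le> ?F z v \<and> ?F z v \<le> c2 * ?N z v"
    if z: "z \<in> K" and v: "v \<in> tangent_space A z" for z v
  proof -
    obtain p where p: "p \<in> P" "z \<in> U p" using z \<F>(3) P(3) by auto
    have e: "0 \<le> ?N z v" "a p * ?N z v \<le> ?F z v" "?F z v \<le> b p * ?N z v"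
      using bspec[OF bspec[OF cmp[unfolded cmp_def] p(2)] v] p(1) P(1) KX
      by (simp_all add: subsetD)
    have "c1 \<le> a p" "b p \<le> c2" using p(1) P(2) by (auto simp: c1_def c2_def)
    then have "c1 * ?N z v \<le> a p * ?N z v" "b p * ?N z v \<le> c2 * ?N z v"
      using e(1) by (auto intro: mult_right_mono)
    then show ?thesis using e by linarith
  qed
  ultimately show ?thesis
    by (intro exI[of _ c1] exI[of _ c2] conjI ballI) auto
qed

end
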